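(* For fixed $\mu\in(0,1)$, the collection of zero-boundary RQM-functions $$\{Z^+_{n,m}[\mu]: n\ge0,\ m\ge1\}\cup\{Z^-_{n,m}[\mu]: n\ge1,\ m\ge1\}$$ is orthogonal over the rectangle $R_{\xi_\mu}=[0,\xi_\mu)\times[0,2\pi]$ with respect to the weighted $L^2$ inner product $\langle f,g\rangle_{\xi_\mu}=\mathrm{Sc}\int_0^{2\pi}\!\int_0^{\xi_\mu}\overline{f}\,g\,\frac{\mu^2}{2}(\cosh2\xi-\cos2\eta)\,d\xi\,d\eta$, and their norms squared are equal to $$\|Z^\pm_{n,m}[\mu]\|^2_{\xi_\mu}=\|\zeta^\pm_{n,m}[\mu]\|^2_{\xi_\mu}+\frac{\mu^2}{4q_{n,m}}(1+\delta_{0,n})\pi\int_0^{\xi_\mu}\big(\psi^\pm_n[q_{n,m}]'(\xi)\big)^2d\xi+\frac{\mu^2}{4q_{n,m}}\Big(\int_0^{2\pi}\big(\phi^\pm_n[q_{n,m}]'(\eta)\big)^2d\eta\Big)\Big(\int_0^{\xi_\mu}\big(\psi^\pm_n[q_{n,m}](\xi)\big)^2d\xi\Big),$$ where $q_{n,m}=q^\pm_{n,m}(\xi_\mu)$ with the corresponding sign, $\delta_{0,n}$ is the Kronecker symbol, and $$\|\zeta^\pm_{n,m}[\mu]\|_{\xi_\mu}^2=\int_0^{2\pi}\!\!\int_0^{\xi_\mu}\big(\zeta^\pm_{n,m}[\mu](\xi,\eta)\big)^2\,\frac{\mu^2}{2}(\cosh2\xi-\cos2\eta)\,d\xi\,d\eta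 .$$
   Context: For $0<\mu<1$, $\xi_\mu>0$ is defined by $\mu\cosh\xi_\mu=1$. $\mathbb{R}^3$ is identified with the reduced quaternions $a_0+\mathbf{i}a_1+\mathbf{j}a_2\in\mathbb{H}$; $\mathrm{Sc}$ denotes the scalar part and the bar quaternionic conjugation. In elliptical coordinates $x=\cosh\xi\cos\eta$, $y=\sinh\xi\sin\eta$, the operator $D=\mathbf{i}\,\partial/\partial x+\mathbf{j}\,\partial/\partial y$ becomes $$\mathcal{D}=\frac{2}{\cosh2\xi-\cos2\eta}\Big((\mathbf{i}\sinh\xi\cos\eta+\mathbf{j}\cosh\xi\sin\eta)\frac{\partial}{\partial\xi}+(\mathbf{j}\sinh\xi\cos\eta-\mathbf{i}\cosh\xi\sin\eta)\frac{\partial}{\partial\eta}\Big).$$ Mathieu functions: for $q>0$, $\phi^+_n[q](\eta)=\mathrm{ce}_n(\eta,q)$ ($n\ge0$) and $\phi^-_n[q](\eta)=\mathrm{se}_n(\eta,q)$ ($n\ge1$) are the even, respectively odd, $2\pi$-periodic solutions of $\phi''+(a-2q\cos2\eta)\phi=0$ for the eigenvalues $a=a_0(q)<a_1(q)<\cdots$, respectively $a=b_1(q)<b_2(q)<\cdots$. They are normalized so that the $L^2([0,2\pi])$-norm is $\sqrt\pi$, except that $\mathrm{ce}_0$ has norm $\sqrt{2\pi}$, with signs such that $\mathrm{ce}_n(\eta,q)\to\cos n\eta$ and $\mathrm{se}_n(\eta,q)\to\sin n\eta$ as $q\to0$. Modified Mathieu functions: $\psi^+_n[q](\xi)=\mathrm{Ce}_n(\xi,q)=\mathrm{ce}_n(i\xi,q)$,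 $\psi^-_n[q](\xi)=\mathrm{Se}_n(\xi,q)=-i\,\mathrm{se}_n(i\xi,q)$. Put $\zeta^\pm_n[q](\xi,\eta)=\psi^\pm_n[q](\xi)\,\phi^\pm_n[q](\eta)$. For $\lambda\in\mathbb{R}\setminus\{0\}$, $M^\pm_n[\lambda]=-\frac1\lambda(\mathcal{D}-\lambda)\,\zeta^\pm_n[\lambda^2/4]$. For fixed $\xi>0$, $q^+_{n,1}(\xi)<q^+_{n,2}(\xi)<\cdots$ denote the positive zeros of $q\mapsto\mathrm{Ce}_n(\xi,q)$, and $q^-_{n,1}(\xi)<q^-_{n,2}(\xi)<\cdots$ those of $q\mapsto\mathrm{Se}_n(\xi,q)$. Put $\zeta^\pm_{n,m}[\mu]=\zeta^\pm_n[q^\pm_{n,m}(\xi_\mu)]$. The zero-boundary RQM-functions are $Z^\pm_{n,m}[\mu]=M^\pm_n\big[2\sqrt{q^\pm_{n,m}(\xi_\mu)}\big]$; their scalar part is $\zeta^\pm_{n,m}[\mu]$. *)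

theory Defs
  imports "HOL-Complex_Analysis.Complex_Analysis"
begin

text \<open>A quaternion \<open>(a, b, c, d)\<close> stands for \<open>a + b i + c j + d k\<close>. The product type supplies
  the real vector space structure and the (componentwise) integral.\<close>

type_synonym quat = "real \<times> real \<times> real \<times> real"

fun qmul :: "quat \<Rightarrow> quat \<Rightarrow> quat" where
  "qmul (a1, b1, c1, d1) (a2, b2, c2, d2) =
     (a1 * a2 - b1 * b2 - c1 * c2 - d1 * d2,
      a1 * b2 + b1 * a2 + c1 * d2 - d1 * c2,
      a1 * c2 - b1 * d2 + c1 * a2 + d1 * b2,
      a1 * d2 + b1 * c2 - c1 * b2 + d1 * a2)"

fun qcnj :: "quat \<Rightarrow> quat" where
  "qcnj (a, b, c, d) = (a, - b, - c, - d)"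

definition Sc :: "quat \<Rightarrow> real" where
  "Sc x = fst x"

definition qreal :: "real \<Rightarrow> quat" where
  "qreal a = (a, 0, 0, 0)"

definition qi :: quat where
  "qi = (0, 1, 0, 0)"

definition qj :: quat where
  "qj = (0, 0, 1, 0)"


definition xi :: "real \<Rightarrow> real" where
  "xi \<mu> = (THE \<xi>. 0 < \<xi> \<and> \<mu> * cosh \<xi> = 1)"

definition Dell :: "(real \<Rightarrow> real \<Rightarrow> quat) \<Rightarrow> real \<Rightarrow> real \<Rightarrow> quat" where
  "Dell f \<xi> \<eta> = (2 / (cosh (2 * \<xi>) - cos (2 * \<eta>))) *\<^sub>R
     (qmul ((sinh \<xi> * cos \<eta>) *\<^sub>R qi + (cosh \<xi> * sin \<eta>) *\<^sub>R qj)
           (vector_derivative (\<lambda>x. f x \<eta>) (at \<xi>))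
    + qmul ((sinh \<xi> * cos \<eta>) *\<^sub>R qj - (cosh \<xi> * sin \<eta>) *\<^sub>R qi)
           (vector_derivative (\<lambda>y. f \<xi> y) (at \<eta>)))"


text \<open>\<open>EvenP\<close> is the superscript \<open>+\<close> (the functions ce, Ce), \<open>OddP\<close> the superscript \<open>-\<close>
  (the functions se, Se).\<close>

datatype parity = EvenP | OddP

fun first_index :: "parity \<Rightarrow> nat" where
  "first_index EvenP = 0"
| "first_index OddP = 1"

fun has_parity :: "parity \<Rightarrow> (real \<Rightarrow> real) \<Rightarrow> bool" where
  "has_parity EvenP f \<longleftrightarrow> (\<forall>x. f (- x) = f x)"
| "has_parity OddP f \<longleftrightarrow> (\<forall>x. f (- x) = - f x)"

fun trig :: "parity \<Rightarrow> nat \<Rightarrow> real \<Rightarrow> real" where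
  "trig EvenP n \<eta> = cos (real n * \<eta>)"
| "trig OddP n \<eta> = sin (real n * \<eta>)"

definition mathieu_solution :: "real \<Rightarrow> real \<Rightarrow> (real \<Rightarrow> real) \<Rightarrow> bool" where
  "mathieu_solution a q \<phi> \<longleftrightarrow>
     (\<exists>\<phi>' \<phi>''. \<forall>\<eta>. (\<phi> has_real_derivative \<phi>' \<eta>) (at \<eta>) \<and>
                (\<phi>' has_real_derivative \<phi>'' \<eta>) (at \<eta>) \<and>
                \<phi>'' \<eta> + (a - 2 * q * cos (2 * \<eta>)) * \<phi> \<eta> = 0)"

definition periodic_mathieu_solution :: "parity \<Rightarrow> real \<Rightarrow> real \<Rightarrow> (real \<Rightarrow> real) \<Rightarrow> bool" where
  "periodic_mathieu_solution s a q \<phi> \<longleftrightarrow>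
     mathieu_solution a q \<phi> \<and> has_parity s \<phi> \<and> (\<forall>\<eta>. \<phi> (\<eta> + 2 * pi) = \<phi> \<eta>)"

definition mathieu_eigenvalues :: "parity \<Rightarrow> real \<Rightarrow> real set" where
  "mathieu_eigenvalues s q =
     {a. \<exists>\<phi>. periodic_mathieu_solution s a q \<phi> \<and> (\<exists>\<eta>. \<phi> \<eta> \<noteq> 0)}"

definition increasing_enumeration :: "nat \<Rightarrow> (nat \<Rightarrow> real) \<Rightarrow> real set \<Rightarrow> bool" where
  "increasing_enumeration k f S \<longleftrightarrow> strict_mono_on {k..} f \<and> f ` {k..} = S"

text \<open>\<open>mathieu_functions \<phi>\<close> says that \<open>\<phi> EvenP n q \<eta>\<close> is \<open>ce\<^sub>n(\<eta>, q)\<close> for \<open>n \<ge> 0\<close> and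
  \<open>\<phi> OddP n q \<eta>\<close> is \<open>se\<^sub>n(\<eta>, q)\<close> for \<open>n \<ge> 1\<close>; \<open>ev\<close> holds the eigenvalues
  \<open>a\<^sub>n(q)\<close> and \<open>b\<^sub>n(q)\<close>.\<close>

definition mathieu_functions :: "(parity \<Rightarrow> nat \<Rightarrow> real \<Rightarrow> real \<Rightarrow> real) \<Rightarrow> bool" where
  "mathieu_functions \<phi> \<longleftrightarrow>
     (\<exists>ev.
       (\<forall>s q. 0 < q \<longrightarrow>
          increasing_enumeration (first_index s) (ev s q) (mathieu_eigenvalues s q)) \<and>
       (\<forall>s n q. first_index s \<le> n \<longrightarrow> 0 < q \<longrightarrow>
          periodic_mathieu_solution s (ev s q n) q (\<phi> s n q) \<and>
          sqrt (integral {0..2 * pi} (\<lambda>\<eta>. (\<phi> s n q \<eta>)\<^sup>2)) =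
            (if s = EvenP \<and> n = 0 then sqrt (2 * pi) else sqrt pi))) \<and>
     (\<forall>s n \<eta>. first_index s \<le> n \<longrightarrow>
        ((\<lambda>q. \<phi> s n q \<eta>) \<longlongrightarrow> trig s n \<eta>) (at_right 0))"

text \<open>The analytic continuation of a function on the real line to the complex plane; it gives
  the meaning of \<open>ce\<^sub>n(i\<xi>, q)\<close> and \<open>se\<^sub>n(i\<xi>, q)\<close>.\<close>

definition entire_extension :: "(real \<Rightarrow> real) \<Rightarrow> complex \<Rightarrow> complex" where
  "entire_extension f =
     (THE F. F holomorphic_on UNIV \<and> (\<forall>x. F (complex_of_real x) = complex_of_real (f x)))"

text \<open>\<open>modified s f\<close> is \<open>f(i\<xi>)\<close> for even and \<open>-i f(i\<xi>)\<close> for odd \<open>f\<close>. These values are real, so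
  \<open>Re\<close> only changes the type.\<close>

fun modified :: "parity \<Rightarrow> (real \<Rightarrow> real) \<Rightarrow> real \<Rightarrow> real" where
  "modified EvenP f \<xi> = Re (entire_extension f (\<i> * complex_of_real \<xi>))"
| "modified OddP f \<xi> = Re (- \<i> * entire_extension f (\<i> * complex_of_real \<xi>))"

text \<open>From here on \<open>\<phi>\<close> is meant to satisfy \<^term>\<open>mathieu_functions \<phi>\<close>.\<close>

definition psi ::
  "(parity \<Rightarrow> nat \<Rightarrow> real \<Rightarrow> real \<Rightarrow> real) \<Rightarrow> parity \<Rightarrow> nat \<Rightarrow> real \<Rightarrow> real \<Rightarrow> real" where
  "psi \<phi> s n q = modified s (\<phi> s n q)"

definition zeta ::
  "(parity \<Rightarrow> nat \<Rightarrow> real \<Rightarrow> real \<Rightarrow> real) \<Rightarrow> parity \<Rightarrow> nat \<Rightarrow> real \<Rightarrow> real \<Rightarrow> real \<Rightarrow> real" where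
  "zeta \<phi> s n q \<xi> \<eta> = psi \<phi> s n q \<xi> * \<phi> s n q \<eta>"

definition Mrqm ::
  "(parity \<Rightarrow> nat \<Rightarrow> real \<Rightarrow> real \<Rightarrow> real) \<Rightarrow> parity \<Rightarrow> nat \<Rightarrow> real \<Rightarrow> real \<Rightarrow> real \<Rightarrow> quat" where
  "Mrqm \<phi> s n l \<xi> \<eta> =
     (let z = (\<lambda>x y. qreal (zeta \<phi> s n (l\<^sup>2 / 4) x y))
      in (- (1 / l)) *\<^sub>R (Dell z \<xi> \<eta> - l *\<^sub>R z \<xi> \<eta>))"

text \<open>\<open>zero_parameters \<phi> \<xi> qz\<close> says that \<open>qz s n 1 < qz s n 2 < \<dots>\<close> are the positive zeros
  of \<open>q \<mapsto> psi \<phi> s n q \<xi>\<close>.\<close>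

definition zero_parameters ::
  "(parity \<Rightarrow> nat \<Rightarrow> real \<Rightarrow> real \<Rightarrow> real) \<Rightarrow> real \<Rightarrow> (parity \<Rightarrow> nat \<Rightarrow> nat \<Rightarrow> real) \<Rightarrow> bool" where
  "zero_parameters \<phi> \<xi> qz \<longleftrightarrow>
     (\<forall>s n. first_index s \<le> n \<longrightarrow>
        increasing_enumeration 1 (qz s n) {q. 0 < q \<and> psi \<phi> s n q \<xi> = 0})"

definition Zrqm ::
  "(parity \<Rightarrow> nat \<Rightarrow> real \<Rightarrow> real \<Rightarrow> real) \<Rightarrow> (parity \<Rightarrow> nat \<Rightarrow> nat \<Rightarrow> real) \<Rightarrow>
   parity \<Rightarrow> nat \<Rightarrow> nat \<Rightarrow> real \<Rightarrow> real \<Rightarrow> quat" where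
  "Zrqm \<phi> qz s n m = Mrqm \<phi> s n (2 * sqrt (qz s n m))"

definition ell_weight :: "real \<Rightarrow> real \<Rightarrow> real \<Rightarrow> real" where
  "ell_weight \<mu> \<xi> \<eta> = \<mu>\<^sup>2 / 2 * (cosh (2 * \<xi>) - cos (2 * \<eta>))"

definition ell_inner ::
  "real \<Rightarrow> (real \<Rightarrow> real \<Rightarrow> quat) \<Rightarrow> (real \<Rightarrow> real \<Rightarrow> quat) \<Rightarrow> real" where
  "ell_inner \<mu> f g =
     Sc (integral {0..2 * pi} (\<lambda>\<eta>. integral {0..xi \<mu>} (\<lambda>\<xi>.
           ell_weight \<mu> \<xi> \<eta> *\<^sub>R qmul (qcnj (f \<xi> \<eta>)) (g \<xi> \<eta>))))"

definition ell_norm :: "real \<Rightarrow> (real \<Rightarrow> real \<Rightarrow> quat) \<Rightarrow> real" where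
  "ell_norm \<mu> f = sqrt (ell_inner \<mu> f f)"

end

theory Submission
  imports Defs
begin

text \<open>A Mathieu solution extends to an entire solution of the same equation, so that \<open>\<psi>\<close> solves
  the modified equation \<open>\<psi>'' = (a - 2q cosh 2\<xi>) \<psi>\<close>. The singular factor of \<open>Dell\<close> cancels against the
  weight, and the inner product of two fields becomes
  \<open>\<mu>\<^sup>2 \<integral>\<integral> (h \<zeta>\<^sub>1 \<zeta>\<^sub>2 + \<nabla>\<zeta>\<^sub>1 \<bullet> \<nabla>\<zeta>\<^sub>2 / (\<lambda>\<^sub>1 \<lambda>\<^sub>2))\<close> with \<open>h = (cosh 2\<xi> - cos 2\<eta>) / 2\<close>; on the
  diagonal this is the norm formula. Since \<open>\<Delta>\<zeta> = -4qh\<zeta>\<close> and \<open>\<zeta>\<close> vanishes at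
  \<open>\<xi> = \<xi>\<^sub>\<mu>\<close>, Green's formula turns the gradient term into \<open>4q\<^sub>1 \<integral>\<integral> h \<zeta>\<^sub>1 \<zeta>\<^sub>2 = 4q\<^sub>2 \<integral>\<integral> h \<zeta>\<^sub>1 \<zeta>\<^sub>2\<close>, so everything
  vanishes when \<open>q\<^sub>1 \<noteq> q\<^sub>2\<close>. When \<open>q\<^sub>1 = q\<^sub>2\<close> the eigenvalues differ, and the radial and the angular
  functions are orthogonal separately; opposite parities are orthogonal in the angle alone.\<close>

section \<open>Entire solutions of linear second-order equations\<close>

text \<open>Comparing coefficients in y'' = p y gives a recursion for the Taylor coefficients of y.
  It keeps |c_n| r^n bounded for every r > 0, so the radius of convergence is infinite.\<close>

lemma fps_second_order_ode_entire:
  fixes p :: "complex fps" and A B :: complex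
  assumes p: "fps_conv_radius p = \<infinity>"
  obtains f where "fps_conv_radius f = \<infinity>" "fps_nth f 0 = A" "fps_nth f 1 = B"
    "fps_deriv (fps_deriv f) = p * f"
proof -
  have "\<exists>c. \<forall>n. c n = (if n = 0 then A else if n = 1 then B
      else (\<Sum>k\<le>n - 2. fps_nth p k * c (n - 2 - k)) / (of_nat n * of_nat (n - 1)))"
  proof -
    define G where "G = (\<lambda>c n. if n = 0 then A else if n = 1 then B
      else (\<Sum>k\<le>n - 2. fps_nth p k * c (n - 2 - k)) / (of_nat n * of_nat (n - 1)))"
    \<comment> \<open>The recursion is course-of-values. Cutting off at n is harmless because
      \<open>G\<close> consults its argument only at indices n - 2 - k < n, in the case n \<ge>
      2.\<close>
    have "wfrec less_than G n = G (wfrec less_than G) n" for n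
    proof -
      have "wfrec less_than G n = G (cut (wfrec less_than G) less_than n) n"
        by (rule wfrec) simp
      also have "\<dots> = G (wfrec less_than G) n"
        unfolding G_def by (auto simp: cut_def intro!: sum.cong arg_cong2[where f="(/)"])
      finally show ?thesis .
    qed
    then show ?thesis unfolding G_def by blast
  qed
  then obtain c where c: "\<And>n. c n = (if n = 0 then A else if n = 1 then B
      else (\<Sum>k\<le>n - 2. fps_nth p k * c (n - 2 - k)) / (of_nat n * of_nat (n - 1)))"
    by blast
  have c2: "c (Suc (Suc n)) * (of_nat (Suc (Suc n)) * of_nat (Suc n)) = (\<Sum>k\<le>n. fps_nth p k * c (n - k))"
    for n
    using of_nat_neq_0[of n, where 'a=complex] of_nat_neq_0[of "Suc n", where 'a=complex]
    by (subst c) (simp del: of_nat_Suc)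
  \<comment> \<open>As soon as \<open>n (n - 1)\<close> exceeds \<open>r\<^sup>2 \<Sum> \<bar>p\<^sub>k\<bar> r\<^sup>k\<close>, the recursion bounds \<open>\<bar>c\<^sub>n\<bar> r\<^sup>n\<close> by the
    maximum of its predecessors.\<close>
  have bounded: "\<exists>K. \<forall>n. norm (c n) * r ^ n \<le> K" if r: "r > 0" for r :: real
  proof -
    define M where "M = (\<Sum>k. norm (fps_nth p k * of_real r ^ k))"
    have sm: "summable (\<lambda>k. norm (fps_nth p k * of_real r ^ k))"
      by (rule norm_summable_fps) (simp add: p)
    have M: "(\<Sum>k\<le>n. norm (fps_nth p k) * r ^ k) \<le> M" for n
      using sum_le_suminf[OF sm, of "{..n}"] r by (simp add: M_def norm_mult norm_power)
    obtain N :: nat where N: "r\<^sup>2 * M \<le> real N" using real_arch_simple by blast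
    define K where "K = Max ((\<lambda>n. norm (c n) * r ^ n) ` {..N + 1})"
    have K: "norm (c n) * r ^ n \<le> K" if "n \<le> N + 1" for n
      unfolding K_def using that by (intro Max_ge) auto
    have K0: "0 \<le> K" using K[of 0] by (simp add: order_trans[OF norm_ge_zero])
    have "norm (c n) * r ^ n \<le> K" for n
    proof (induction n rule: less_induct)
      case (less n)
      show ?case
      proof (cases "n \<le> N + 1")
        case False
        then obtain m where m: "n = Suc (Suc m)" "N \<le> m"
          by (metis Suc_eq_plus1 Suc_le_D not_less_eq_eq not_less_eq Suc_le_mono)
        have "norm (c n) * r ^ n * (real (Suc (Suc m)) * real (Suc m))
            = norm (c n * (of_nat (Suc (Suc m)) * of_nat (Suc m))) * r ^ n"
          by (simp only: norm_mult norm_of_nat) (simp add: mult_ac)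
        also have "\<dots> = norm (\<Sum>k\<le>m. fps_nth p k * c (m - k)) * r ^ n"
          by (simp only: m(1) c2)
        also have "\<dots> \<le> (\<Sum>k\<le>m. norm (fps_nth p k) * norm (c (m - k))) * r ^ n"
          using r by (intro mult_right_mono order_trans[OF norm_sum]) (auto simp: norm_mult)
        also have "\<dots> = r\<^sup>2 * (\<Sum>k\<le>m. (norm (fps_nth p k) * r ^ k) * (norm (c (m - k)) * r ^ (m - k)))"
          unfolding sum_distrib_left sum_distrib_right
        proof (rule sum.cong[OF refl])
          fix k assume "k \<in> {..m}"
          then have "r ^ n = r\<^sup>2 * (r ^ k * r ^ (m - k))"
            unfolding m(1) by (simp flip: power_add)
          then show "norm (fps_nth p k) * norm (c (m - k)) * r ^ n =
              r\<^sup>2 * (norm (fps_nth p k) * r ^ k * (norm (c (m - k)) * r ^ (m - k)))"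
            by simp
        qed
        also have "\<dots> \<le> r\<^sup>2 * (\<Sum>k\<le>m. (norm (fps_nth p k) * r ^ k) * K)"
          using r m(1) by (intro mult_left_mono sum_mono less.IH) auto
        also have "\<dots> = r\<^sup>2 * (\<Sum>k\<le>m. norm (fps_nth p k) * r ^ k) * K"
          by (simp add: sum_distrib_right)
        also have "\<dots> \<le> r\<^sup>2 * M * K"
          using K0 by (intro mult_right_mono mult_left_mono M) auto
        also have "\<dots> \<le> real N * K" using N K0 by (rule mult_right_mono)
        also have "\<dots> \<le> (real (Suc (Suc m)) * real (Suc m)) * K"
        proof (rule mult_right_mono[OF _ K0])
          have "real N * 1 \<le> real (Suc (Suc m)) * real (Suc m)"
            using m(2) by (intro mult_mono) auto
          then show "real N \<le> real (Suc (Suc m)) * real (Suc m)" by simp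
        qed
        finally have "norm (c n) * r ^ n * (real (Suc (Suc m)) * real (Suc m))
            \<le> K * (real (Suc (Suc m)) * real (Suc m))" by (simp add: mult_ac)
        then show ?thesis by (rule mult_right_le_imp_le) (simp add: mult_pos_pos del: of_nat_Suc)
      qed (use K in auto)
    qed
    then show ?thesis by blast
  qed
  define f where "f = Abs_fps c"
  have "conv_radius c \<ge> \<infinity>"
  proof (rule conv_radius_geI_ex')
    fix r :: real assume r: "0 < r"
    \<comment> \<open>Boundedness at a radius yields absolute convergence only strictly inside it,
      hence the bound at 2r.\<close>
    obtain K where K: "\<And>n. norm (c n) * (2 * r) ^ n \<le> K" using bounded[of "2 * r"] r by auto
    have "summable (\<lambda>n. norm (c n) * r ^ n)"
      by (rule Abel_lemma[of r "2 * r" c K]) (use r K in auto)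
    then show "summable (\<lambda>n. c n * of_real r ^ n)"
      using r by - (rule summable_norm_cancel, simp add: norm_mult norm_power)
  qed
  then have "fps_conv_radius f = \<infinity>" by (simp add: f_def fps_conv_radius_def)
  moreover have "fps_deriv (fps_deriv f) = p * f"
  proof (rule fps_ext)
    fix n
    have "fps_nth (fps_deriv (fps_deriv f)) n = c (Suc (Suc n)) * (of_nat (Suc (Suc n)) * of_nat (Suc n))"
      by (simp add: f_def algebra_simps)
    also have "\<dots> = fps_nth (p * f) n"
      by (simp only: c2 fps_mult_nth f_def) (simp add: atLeast0AtMost)
    finally show "fps_nth (fps_deriv (fps_deriv f)) n = fps_nth (p * f) n" .
  qed
  moreover have "fps_nth f 0 = A" "fps_nth f 1 = B" unfolding f_def by (simp_all add: c)
  ultimately show ?thesis using that by blast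
qed

text \<open>Uniqueness for the initial value problem at 0. It serves to identify a power series
  solution on the real line with a given solution.\<close>

lemma second_order_ode_zero:
  fixes g g' P :: "real \<Rightarrow> real"
  assumes g: "\<And>x. (g has_real_derivative g' x) (at x)"
    and g': "\<And>x. (g' has_real_derivative P x * g x) (at x)"
    and P: "\<And>x. \<bar>P x\<bar> \<le> C" and "g 0 = 0" "g' 0 = 0"
  shows "g x = 0"
proof -
  \<comment> \<open>Gronwall: \<open>\<bar>E'\<bar> \<le> K E\<close> and \<open>E 0 = 0\<close>.\<close>
  define E where "E = (\<lambda>x. (g x)\<^sup>2 + (g' x)\<^sup>2)"
  define K where "K = 1 + C"
  have dE: "(E has_real_derivative (2 * g x * g' x * (1 + P x))) (at x)" for x
    unfolding E_def by (auto intro!: derivative_eq_intros g g' simp: algebra_simps)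
  \<comment> \<open>The choice K = 1 + C comes from 2 |g g'| \<le> E (arithmetic-geometric mean) and
    |1 + P| \<le> 1 + C.\<close>
  have bound: "\<bar>2 * g x * g' x * (1 + P x)\<bar> \<le> K * E x" for x
  proof -
    have "2 * \<bar>g x\<bar> * \<bar>g' x\<bar> \<le> E x"
      using sum_squares_bound[of "\<bar>g x\<bar>" "\<bar>g' x\<bar>"] by (simp add: E_def)
    moreover have "\<bar>1 + P x\<bar> \<le> K" using P[of x] by (simp add: K_def)
    ultimately have "(2 * \<bar>g x\<bar> * \<bar>g' x\<bar>) * \<bar>1 + P x\<bar> \<le> E x * K"
      by (intro mult_mono) (auto simp: E_def)
    also have "(2 * \<bar>g x\<bar> * \<bar>g' x\<bar>) * \<bar>1 + P x\<bar> = \<bar>2 * g x * g' x * (1 + P x)\<bar>"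
      by (simp only: abs_mult abs_numeral)
    finally show ?thesis by (simp only: mult.commute)
  qed
  have E0: "E 0 = 0" by (simp add: E_def assms)
  \<comment> \<open>The sign of the exponent depends on the side of 0: E exp(-Kx) decreases to the
    right of 0, and E exp(Kx) increases up to 0 from the left.\<close>
  have "E x \<le> 0"
  proof (cases "x \<ge> 0")
    case True
    have "E x * exp (- K * x) \<le> E 0 * exp (- K * 0)"
    proof (rule DERIV_nonpos_imp_nonincreasing[OF True])
      fix t
      have "((\<lambda>x. E x * exp (- K * x)) has_real_derivative
          (2 * g t * g' t * (1 + P t) - K * E t) * exp (- K * t)) (at t)"
        by (auto intro!: derivative_eq_intros dE simp: algebra_simps)
      moreover have "(2 * g t * g' t * (1 + P t) - K * E t) * exp (- K * t) \<le> 0"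
        using bound[of t] by (intro mult_nonpos_nonneg) auto
      ultimately show "\<exists>y. ((\<lambda>x. E x * exp (- K * x)) has_real_derivative y) (at t) \<and> y \<le> 0"
        by blast
    qed
    then show ?thesis by (simp add: E0 mult_le_0_iff)
  next
    case False
    then have "x \<le> 0" by simp
    have "E x * exp (K * x) \<le> E 0 * exp (K * 0)"
    proof (rule DERIV_nonneg_imp_nondecreasing[OF \<open>x \<le> 0\<close>])
      fix t
      have "((\<lambda>x. E x * exp (K * x)) has_real_derivative
          (2 * g t * g' t * (1 + P t) + K * E t) * exp (K * t)) (at t)"
        by (auto intro!: derivative_eq_intros dE simp: algebra_simps)
      moreover have "0 \<le> (2 * g t * g' t * (1 + P t) + K * E t) * exp (K * t)"
        using bound[of t] by (intro mult_nonneg_nonneg) auto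
      ultimately show "\<exists>y. ((\<lambda>x. E x * exp (K * x)) has_real_derivative y) (at t) \<and> 0 \<le> y"
        by blast
    qed
    then show ?thesis by (simp add: E0 mult_le_0_iff)
  qed
  then show ?thesis by (simp add: E_def sum_power2_le_zero_iff)
qed

text \<open>The power series solution with the initial data of \<open>f\<close> at 0 is entire. On
  the real line the coefficient of the equation is real, so Im F and Re F - f both solve it with
  zero data and vanish.\<close>

lemma mathieu_entire:
  assumes "mathieu_solution a q f"
  obtains F F' where
    "\<And>z. (F has_field_derivative F' z) (at z)"
    "\<And>z. (F' has_field_derivative (- (of_real a - 2 * of_real q * cos (2 * z)) * F z)) (at z)"
    "\<And>x. F (of_real x) = of_real (f x)" "Im (F' 0) = 0"
proof -
  obtain f1 f2 where f: "\<And>x. (f has_real_derivative f1 x) (at x)"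
    "\<And>x. (f1 has_real_derivative f2 x) (at x)" "\<And>x. f2 x + (a - 2 * q * cos (2 * x)) * f x = 0"
    using assms unfolding mathieu_solution_def by blast
  have f2: "f2 x = - (a - 2 * q * cos (2 * x)) * f x" for x using f(3)[of x] by algebra
  \<comment> \<open>This is the Taylor series of 2q cos 2z - a; \<open>fps_cos 2\<close> is the
    series of cos 2z.\<close>
  define p :: "complex fps" where "p = fps_const (2 * of_real q) * fps_cos 2 - fps_const (of_real a)"
  have rc: "fps_conv_radius (fps_const (2 * complex_of_real q) * fps_cos 2) = \<infinity>"
    using fps_conv_radius_mult[of "fps_const (2 * complex_of_real q)" "fps_cos 2"] by simp
  have rp: "fps_conv_radius p = \<infinity>"
    unfolding p_def
    using fps_conv_radius_diff[of "fps_const (2 * complex_of_real q) * fps_cos 2"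
        "fps_const (complex_of_real a)"] rc by simp
  obtain h where h: "fps_conv_radius h = \<infinity>" "fps_nth h 0 = of_real (f 0)" "fps_nth h 1 = of_real (f1 0)"
    "fps_deriv (fps_deriv h) = p * h"
    using fps_second_order_ode_entire[OF rp] by blast
  have rh': "fps_conv_radius (fps_deriv h) = \<infinity>"
    using fps_conv_radius_deriv[of h] h(1) by simp
  have ep: "eval_fps p z = - (of_real a - 2 * of_real q * cos (2 * z))" for z
    unfolding p_def by (subst eval_fps_diff) (simp_all add: rc eval_fps_mult)
  define F where "F = eval_fps h"
  define F' where "F' = eval_fps (fps_deriv h)"
  have dF: "(F has_field_derivative F' z) (at z)" for z
    unfolding F_def F'_def by (rule has_field_derivative_eval_fps) (simp add: h)
  have dF': "(F' has_field_derivative (- (of_real a - 2 * of_real q * cos (2 * z)) * F z)) (at z)" for z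
  proof -
    have "(F' has_field_derivative eval_fps (fps_deriv (fps_deriv h)) z) (at z)"
      unfolding F'_def by (rule has_field_derivative_eval_fps) (simp add: rh')
    then show ?thesis by (simp add: h(4) eval_fps_mult rp h(1) ep F_def)
  qed
  have F0: "F 0 = of_real (f 0)" "F' 0 = of_real (f1 0)"
    by (simp_all add: F_def F'_def eval_fps_at_0 h flip: One_nat_def)
  have coeff: "- (complex_of_real a - 2 * of_real q * cos (2 * of_real x))
      = of_real (- (a - 2 * q * cos (2 * x)))" for x
  proof -
    have "cos (2 * complex_of_real x) = of_real (cos (2 * x))"
      by (metis cos_of_real of_real_mult of_real_numeral)
    then show ?thesis by simp
  qed
  have dF_real: "((\<lambda>x. F (of_real x)) has_vector_derivative F' (of_real x)) (at x)" for x
    using has_vector_derivative_real_field[OF dF, of x UNIV] by simp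
  have dF'_real: "((\<lambda>x. F' (of_real x)) has_vector_derivative
      of_real (- (a - 2 * q * cos (2 * x))) * F (of_real x)) (at x)" for x
    using has_vector_derivative_real_field[OF dF', of x UNIV] by (simp only: coeff)
  have bnd: "\<bar>- (a - 2 * q * cos (2 * x))\<bar> \<le> \<bar>a\<bar> + 2 * \<bar>q\<bar>" for x
  proof -
    have "\<bar>2 * q * cos (2 * x)\<bar> \<le> 2 * \<bar>q\<bar> * 1"
      unfolding abs_mult by (intro mult_mono) auto
    then show ?thesis by linarith
  qed
  have im: "Im (F (of_real x)) = 0" for x
  proof (rule second_order_ode_zero[where g = "\<lambda>x. Im (F (of_real x))" and g' = "\<lambda>x. Im (F' (of_real x))"
        and P = "\<lambda>x. - (a - 2 * q * cos (2 * x))", OF _ _ bnd])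
    show "((\<lambda>x. Im (F (of_real x))) has_real_derivative Im (F' (of_real x))) (at x)" for x
      using bounded_linear.has_vector_derivative[OF bounded_linear_Im dF_real]
      by (simp add: has_real_derivative_iff_has_vector_derivative)
    show "((\<lambda>x. Im (F' (of_real x))) has_real_derivative
        - (a - 2 * q * cos (2 * x)) * Im (F (of_real x))) (at x)" for x
      using bounded_linear.has_vector_derivative[OF bounded_linear_Im dF'_real]
      by (simp add: has_real_derivative_iff_has_vector_derivative)
  qed (simp_all add: F0)
  have re: "Re (F (of_real x)) - f x = 0" for x
  proof (rule second_order_ode_zero[where g = "\<lambda>x. Re (F (of_real x)) - f x"
        and g' = "\<lambda>x. Re (F' (of_real x)) - f1 x"
        and P = "\<lambda>x. - (a - 2 * q * cos (2 * x))", OF _ _ bnd])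
    fix x
    have "((\<lambda>x. Re (F (of_real x))) has_real_derivative Re (F' (of_real x))) (at x)"
      using bounded_linear.has_vector_derivative[OF bounded_linear_Re dF_real]
      by (simp add: has_real_derivative_iff_has_vector_derivative)
    from DERIV_diff[OF this f(1)]
    show "((\<lambda>x. Re (F (of_real x)) - f x) has_real_derivative Re (F' (of_real x)) - f1 x) (at x)" .
    have "((\<lambda>x. Re (F' (of_real x))) has_real_derivative
        - (a - 2 * q * cos (2 * x)) * Re (F (of_real x))) (at x)"
      using bounded_linear.has_vector_derivative[OF bounded_linear_Re dF'_real]
      by (simp add: has_real_derivative_iff_has_vector_derivative)
    from DERIV_diff[OF this f(2)]
    show "((\<lambda>x. Re (F' (of_real x)) - f1 x) has_real_derivative
        - (a - 2 * q * cos (2 * x)) * (Re (F (of_real x)) - f x)) (at x)"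
      by (simp add: f2 algebra_simps)
  qed (simp_all add: F0)
  have "F (of_real x) = of_real (f x)" for x using im[of x] re[of x] by (simp add: complex_eq_iff)
  with that[OF dF dF'] show ?thesis by (simp add: F0)
qed

section \<open>Continuation to the imaginary axis: modified Mathieu functions\<close>

text \<open>The identity theorem makes the definite description meaningful: 0 is a limit point of
  the real line, so real values determine an entire function.\<close>

lemma entire_extension_eqI:
  assumes F: "F holomorphic_on UNIV" "\<And>x. F (of_real x) = of_real (f x)"
  shows "entire_extension f = F"
  unfolding entire_extension_def
proof (rule the_equality)
  fix G assume G: "G holomorphic_on UNIV \<and> (\<forall>x. G (complex_of_real x) = complex_of_real (f x))"
  have lim: "(0::complex) islimpt range of_real"
    unfolding islimpt_approachable
  proof (intro allI impI)
    fix e :: real assume "e > 0"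
    then show "\<exists>x'\<in>range complex_of_real. x' \<noteq> 0 \<and> dist x' 0 < e"
      by (intro bexI[of _ "of_real (e / 2)"] rangeI) auto
  qed
  have "G z - F z = 0" for z
    by (rule analytic_continuation[where f = "\<lambda>z. G z - F z" and S = UNIV and U = "range of_real", OF _ _ _ _ _ lim])
      (use F G in \<open>auto intro!: holomorphic_intros\<close>)
  then show "G = F" by auto
qed (use F in auto)

text \<open>Substituting z = ix multiplies the second derivative by -1 and turns cos 2z into cosh
  2x. The conditions at 0 will remove the boundary term there in Green's formula.\<close>

lemma modified_mathieu:
  assumes "mathieu_solution a q f"
  obtains g' where
    "\<And>x. (modified s f has_real_derivative g' x) (at x)"
    "\<And>x. (g' has_real_derivative (a - 2 * q * cosh (2 * x)) * modified s f x) (at x)"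
    "s = OddP \<Longrightarrow> modified s f 0 = 0" "s = EvenP \<Longrightarrow> g' 0 = 0"
proof -
  obtain F F' where F: "\<And>z. (F has_field_derivative F' z) (at z)"
    "\<And>z. (F' has_field_derivative (- (of_real a - 2 * of_real q * cos (2 * z)) * F z)) (at z)"
    "\<And>x. F (of_real x) = of_real (f x)" "Im (F' 0) = 0"
    using mathieu_entire[OF assms] by blast
  have FE: "entire_extension f = F"
    by (rule entire_extension_eqI) (use F in \<open>auto simp: holomorphic_on_def field_differentiable_def
          intro: has_field_derivative_at_within\<close>)
  \<comment> \<open>This factor treats both parities at once.\<close>
  define c :: complex where "c = (if s = EvenP then 1 else - \<i>)"
  have m: "modified s f = (\<lambda>x. Re (c * F (\<i> * of_real x)))"
    by (rule ext, cases s) (simp_all add: FE c_def)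
  have cos: "cos (2 * (\<i> * complex_of_real x)) = of_real (cosh (2 * x))" for x
    using cosh_conv_cos[of "of_real (2 * x) :: complex"] by (simp add: cosh_field_def mult_ac flip: exp_of_real)
  have d1: "((\<lambda>z. c * F (\<i> * z)) has_field_derivative c * (F' (\<i> * z) * \<i>)) (at z)" for z
    by (intro DERIV_cmult DERIV_chain2[OF F(1)] derivative_eq_intros) auto
  have d2: "((\<lambda>z. c * (F' (\<i> * z) * \<i>)) has_field_derivative
      (of_real a - 2 * of_real q * cos (2 * (\<i> * z))) * (c * F (\<i> * z))) (at z)" for z
  proof -
    have "((\<lambda>z. c * (F' (\<i> * z) * \<i>)) has_field_derivative
      c * (- (of_real a - 2 * of_real q * cos (2 * (\<i> * z))) * F (\<i> * z) * \<i> * \<i>)) (at z)"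
      by (intro DERIV_cmult DERIV_cmult_right DERIV_chain2[OF F(2)] derivative_eq_intros) auto
    moreover have "c * (- k * F (\<i> * z) * \<i> * \<i>) = k * (c * F (\<i> * z))" for k
      using i_squared by algebra
    ultimately show ?thesis by (simp only:)
  qed
  have r1: "(modified s f has_real_derivative Re (c * (F' (\<i> * of_real x) * \<i>))) (at x)" for x
    using bounded_linear.has_vector_derivative[OF bounded_linear_Re has_vector_derivative_real_field[OF d1, of x UNIV]]
    by (simp add: m has_real_derivative_iff_has_vector_derivative)
  have r2: "((\<lambda>x. Re (c * (F' (\<i> * of_real x) * \<i>))) has_real_derivative
      (a - 2 * q * cosh (2 * x)) * modified s f x) (at x)" for x
  proof -
    have "((\<lambda>x. Re (c * (F' (\<i> * of_real x) * \<i>))) has_vector_derivative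
      Re ((of_real a - 2 * of_real q * cos (2 * (\<i> * of_real x))) * (c * F (\<i> * of_real x)))) (at x)"
      using bounded_linear.has_vector_derivative[OF bounded_linear_Re has_vector_derivative_real_field[OF d2, of x UNIV]]
      by simp
    also have "Re ((of_real a - 2 * of_real q * cos (2 * (\<i> * of_real x))) * (c * F (\<i> * of_real x)))
      = Re (of_real (a - 2 * q * cosh (2 * x)) * (c * F (\<i> * of_real x)))"
      by (simp only: cos) simp
    also have "\<dots> = (a - 2 * q * cosh (2 * x)) * modified s f x"
      by (simp only: m Re_complex_of_real Im_complex_of_real times_complex.sel)
    finally show ?thesis by (simp only: has_real_derivative_iff_has_vector_derivative)
  qed
  show ?thesis
  proof (rule that[OF r1 r2])
    \<comment> \<open>F is real at 0 and so is its derivative: in the odd case the value is Im F(0),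
      in the even case the derivative is -Im F'(0).\<close>
    show "modified s f 0 = 0" if "s = OddP" using F(3)[of 0] that by (simp add: FE m c_def)
    show "Re (c * (F' (\<i> * of_real 0) * \<i>)) = 0" if "s = EvenP" using F(4) that by (simp add: c_def)
  qed
qed

section \<open>The elliptical weight and elementary facts on integrals\<close>

lemma xi_pos:
  assumes "0 < \<mu>" "\<mu> < 1"
  shows "0 < xi \<mu>"
proof -
  have *: "0 < arcosh (1 / \<mu>) \<and> \<mu> * cosh (arcosh (1 / \<mu>)) = 1" using assms by simp
  have "xi \<mu> = arcosh (1 / \<mu>)"
    unfolding xi_def
  proof (rule the_equality)
    show "0 < arcosh (1 / \<mu>) \<and> \<mu> * cosh (arcosh (1 / \<mu>)) = 1" by (fact *)
  next
    fix x assume x: "0 < x \<and> \<mu> * cosh x = 1"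
    then have "cosh x = 1 / \<mu>" using assms by (simp add: field_simps)
    then show "x = arcosh (1 / \<mu>)" using x arcosh_cosh_real[of x] by simp
  qed
  with * show ?thesis by simp
qed

lemma continuous_on_DERIV:
  fixes f :: "real \<Rightarrow> real"
  assumes "\<And>x. (f has_real_derivative f' x) (at x)"
  shows "continuous_on S f"
  using assms by (meson DERIV_isCont continuous_at_imp_continuous_on)

text \<open>Reflection carries the integral to [-p, 0] with a change of sign, and the period shift
  carries it back, so it equals its own negative.\<close>

lemma integral_odd_periodic:
  fixes f :: "real \<Rightarrow> real"
  assumes "\<And>x. f (- x) = - f x" "\<And>x. f (x + p) = f x"
  shows "integral {0..p} f = 0"
proof -
  have "integral {0..p} f = integral {- p..- 0} (\<lambda>x. f (- x))"
    by (rule Henstock_Kurzweil_Integration.integral_reflect_real[symmetric])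
  also have "\<dots> = - integral {0 - p..p - p} (\<lambda>x. f (x + p))" by (simp add: assms)
  also have "\<dots> = - integral {0..p} f" by (simp only: integral_shift_real_ivl)
  finally show ?thesis by simp
qed

text \<open>Since cosh 2x \<ge> 1 \<ge> cos 2y, a zero forces cosh 2x = 1. Hence the singularity of
  \<open>Dell\<close> meets each inner integral in a null set at most.\<close>

lemma elliptic_weight_vanishes:
  assumes "cosh (2 * x) - cos (2 * y) = (0::real)"
  shows "x = 0"
proof -
  have "cosh (2 * x) \<le> 1" using assms cos_le_one[of "2 * y"] by linarith
  then show ?thesis using cosh_real_strict_mono[of 0 "\<bar>2 * x\<bar>"] by (cases "x = 0") auto
qed

text \<open>Half of the left side is |sinh(x + iy)|^2, the Jacobian of the conformal map w \<mapsto>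
  cosh w behind elliptical coordinates.\<close>

lemma elliptic_weight_eq:
  "cosh (2 * x) - cos (2 * y) = 2 * ((sinh x * cos y)\<^sup>2 + (cosh x * sin y)\<^sup>2)" for x y :: real
proof -
  have "cosh (2 * x) = 2 * (sinh x)\<^sup>2 + 1" by (simp add: cosh_double cosh_square_eq)
  moreover have "cos (2 * y) = 1 - 2 * (sin y)\<^sup>2" by (rule cos_double_sin)
  moreover have "(cosh x)\<^sup>2 = (sinh x)\<^sup>2 + 1" by (rule cosh_square_eq)
  moreover have "(cos y)\<^sup>2 = 1 - (sin y)\<^sup>2" by (simp add: cos_squared_eq)
  ultimately show ?thesis by algebra
qed

section \<open>The operator on separated fields and reduction to one-variable integrals\<close>

text \<open>Up to the factor k, the components along i and j are the real and imaginary parts of the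
  complex product (p + ir)(\<alpha> + i\<beta>), where \<alpha>, \<beta> are the partial derivatives
  and p + ir = sinh(\<xi> + i\<eta>).\<close>

lemma Dell_separated:
  assumes "\<And>x. (u has_real_derivative u' x) (at x)" "\<And>x. (v has_real_derivative v' x) (at x)"
  shows "Dell (\<lambda>x y. qreal (u x * v y)) \<xi> \<eta> =
    (let p = sinh \<xi> * cos \<eta>; r = cosh \<xi> * sin \<eta>; k = 2 / (cosh (2 * \<xi>) - cos (2 * \<eta>));
         \<alpha> = u' \<xi> * v \<eta>; \<beta> = u \<xi> * v' \<eta>
     in (0, k * (p * \<alpha> - r * \<beta>), k * (r * \<alpha> + p * \<beta>), 0))"
proof -
  have qreal_eq: "qreal = (\<lambda>a. a *\<^sub>R (1, 0, 0, 0) :: quat)"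
    by (auto simp: qreal_def fun_eq_iff zero_prod_def)
  have lin: "bounded_linear qreal"
    unfolding qreal_eq by (rule bounded_linear_scaleR_left)
  have "((\<lambda>x. qreal (u x * v \<eta>)) has_vector_derivative qreal (u' \<xi> * v \<eta>)) (at \<xi>)"
    by (rule bounded_linear.has_vector_derivative[OF lin])
      (auto simp flip: has_real_derivative_iff_has_vector_derivative intro!: derivative_eq_intros assms)
  moreover have "((\<lambda>y. qreal (u \<xi> * v y)) has_vector_derivative qreal (u \<xi> * v' \<eta>)) (at \<eta>)"
    by (rule bounded_linear.has_vector_derivative[OF lin])
      (auto simp flip: has_real_derivative_iff_has_vector_derivative intro!: derivative_eq_intros assms)
  ultimately show ?thesis
    by (simp add: Dell_def vector_derivative_at qreal_def qi_def qj_def Let_def algebra_simps)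
qed

text \<open>Multiplication by p + ir is a similarity of the plane, so dot and cross products of the
  vectors (X, Y) are h times those of (a, b). This h and the weight together cancel the two factors
  1/h.\<close>

lemma weighted_quaternion_product:
  fixes p r h :: real
  assumes h: "h = p\<^sup>2 + r\<^sup>2" "h \<noteq> 0"
  defines "X \<equiv> \<lambda>\<alpha> \<beta>. p * \<alpha> - r * \<beta>" and "Y \<equiv> \<lambda>\<alpha> \<beta>. r * \<alpha> + p * \<beta>"
  shows "h *\<^sub>R qmul (qcnj (z1, - s1 * (X a1 b1 / h), - s1 * (Y a1 b1 / h), 0))
                    (z2, - s2 * (X a2 b2 / h), - s2 * (Y a2 b2 / h), 0) =
    (h * z1 * z2 + s1 * s2 * (a1 * a2 + b1 * b2),
     s1 * z2 * X a1 b1 - s2 * z1 * X a2 b2,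
     s1 * z2 * Y a1 b1 - s2 * z1 * Y a2 b2,
     - s1 * s2 * (a1 * b2 - b1 * a2))"
proof -
  have "h * (s1 * (X a1 b1 / h) * (s2 * (X a2 b2 / h)) + s1 * (Y a1 b1 / h) * (s2 * (Y a2 b2 / h)))
      = s1 * s2 * (X a1 b1 * X a2 b2 + Y a1 b1 * Y a2 b2) / h"
    using h(2) by (simp add: field_simps)
  also have "X a1 b1 * X a2 b2 + Y a1 b1 * Y a2 b2 = (a1 * a2 + b1 * b2) * h"
    unfolding X_def Y_def h(1) by algebra
  finally have 1: "h * (s1 * (X a1 b1 / h) * (s2 * (X a2 b2 / h)) + s1 * (Y a1 b1 / h) * (s2 * (Y a2 b2 / h)))
      = s1 * s2 * (a1 * a2 + b1 * b2)" using h(2) by simp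
  have "h * (s1 * (X a1 b1 / h) * (s2 * (Y a2 b2 / h)) - s1 * (Y a1 b1 / h) * (s2 * (X a2 b2 / h)))
      = s1 * s2 * (X a1 b1 * Y a2 b2 - Y a1 b1 * X a2 b2) / h"
    using h(2) by (simp add: field_simps)
  also have "X a1 b1 * Y a2 b2 - Y a1 b1 * X a2 b2 = (a1 * b2 - b1 * a2) * h"
    unfolding X_def Y_def h(1) by algebra
  finally have 2: "h * (s1 * (X a1 b1 / h) * (s2 * (Y a2 b2 / h)) - s1 * (Y a1 b1 / h) * (s2 * (X a2 b2 / h)))
      = s1 * s2 * (a1 * b2 - b1 * a2)" using h(2) by simp
  from 1 2 h(2) show ?thesis by (simp add: algebra_simps)
qed

text \<open>Four terms are what the scalar part of the inner product needs: two from the weight and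
  two from the gradients.\<close>

lemma integral_separated_sum:
  fixes f1 f2 f3 f4 g1 g2 g3 g4 :: "real \<Rightarrow> real"
  assumes "continuous_on {a..b} f1" "continuous_on {a..b} f2" "continuous_on {a..b} f3" "continuous_on {a..b} f4"
    and "continuous_on {c..d} g1" "continuous_on {c..d} g2" "continuous_on {c..d} g3" "continuous_on {c..d} g4"
  shows "integral {c..d} (\<lambda>y. integral {a..b} (\<lambda>x. f1 x * (k1 * g1 y) + f2 x * (k2 * g2 y) + f3 x * (k3 * g3 y) + f4 x * (k4 * g4 y))) =
    integral {a..b} f1 * (k1 * integral {c..d} g1) + integral {a..b} f2 * (k2 * integral {c..d} g2)
    + integral {a..b} f3 * (k3 * integral {c..d} g3) + integral {a..b} f4 * (k4 * integral {c..d} g4)"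
proof -
  note i = integrable_continuous_real[OF assms(1)] integrable_continuous_real[OF assms(2)]
    integrable_continuous_real[OF assms(3)] integrable_continuous_real[OF assms(4)]
    integrable_continuous_real[OF assms(5)] integrable_continuous_real[OF assms(6)]
    integrable_continuous_real[OF assms(7)] integrable_continuous_real[OF assms(8)]
  have inner: "((\<lambda>x. f1 x * (k1 * g1 y) + f2 x * (k2 * g2 y) + f3 x * (k3 * g3 y) + f4 x * (k4 * g4 y)) has_integral
     (integral {a..b} f1 * (k1 * g1 y) + integral {a..b} f2 * (k2 * g2 y) + integral {a..b} f3 * (k3 * g3 y)
        + integral {a..b} f4 * (k4 * g4 y))) {a..b}" for y
    by (intro has_integral_add has_integral_mult_left integrable_integral i)
  have "((\<lambda>y. integral {a..b} f1 * (k1 * g1 y) + integral {a..b} f2 * (k2 * g2 y) + integral {a..b} f3 * (k3 * g3 y)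
        + integral {a..b} f4 * (k4 * g4 y)) has_integral
     (integral {a..b} f1 * (k1 * integral {c..d} g1) + integral {a..b} f2 * (k2 * integral {c..d} g2)
    + integral {a..b} f3 * (k3 * integral {c..d} g3) + integral {a..b} f4 * (k4 * integral {c..d} g4))) {c..d}"
    by (intro has_integral_add has_integral_mult_right integrable_integral i)
  then show ?thesis unfolding integral_unique[OF inner] by (rule integral_unique)
qed

text \<open>The factors \<open>s1\<close>, \<open>s2\<close> play the role of 1/\<lambda> in
  \<open>Mrqm\<close>. After the cancellation the integrand extends continuously, and its scalar
  component is a sum of products of a radial and an angular function.\<close>

lemma ell_inner_separated:
  fixes u1 u2 v1 v2 u1' u2' v1' v2' :: "real \<Rightarrow> real"
  assumes u1: "\<And>x. (u1 has_real_derivative u1' x) (at x)" and u2: "\<And>x. (u2 has_real_derivative u2' x) (at x)"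
    and v1: "\<And>x. (v1 has_real_derivative v1' x) (at x)" and v2: "\<And>x. (v2 has_real_derivative v2' x) (at x)"
    and c: "continuous_on UNIV u1'" "continuous_on UNIV u2'" "continuous_on UNIV v1'" "continuous_on UNIV v2'"
  shows "ell_inner \<mu>
      (\<lambda>\<xi> \<eta>. qreal (u1 \<xi> * v1 \<eta>) - s1 *\<^sub>R Dell (\<lambda>x y. qreal (u1 x * v1 y)) \<xi> \<eta>)
      (\<lambda>\<xi> \<eta>. qreal (u2 \<xi> * v2 \<eta>) - s2 *\<^sub>R Dell (\<lambda>x y. qreal (u2 x * v2 y)) \<xi> \<eta>) =
    \<mu>\<^sup>2 / 2 * (integral {0..xi \<mu>} (\<lambda>x. cosh (2 * x) * u1 x * u2 x) * integral {0..2 * pi} (\<lambda>y. v1 y * v2 y)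
        - integral {0..xi \<mu>} (\<lambda>x. u1 x * u2 x) * integral {0..2 * pi} (\<lambda>y. cos (2 * y) * v1 y * v2 y))
    + \<mu>\<^sup>2 * s1 * s2 * (integral {0..xi \<mu>} (\<lambda>x. u1' x * u2' x) * integral {0..2 * pi} (\<lambda>y. v1 y * v2 y)
        + integral {0..xi \<mu>} (\<lambda>x. u1 x * u2 x) * integral {0..2 * pi} (\<lambda>y. v1' y * v2' y))"
    (is "ell_inner \<mu> ?f1 ?f2 = ?rhs")
proof -
  define p where "p = (\<lambda>x y::real. sinh x * cos y)"
  define r where "r = (\<lambda>x y::real. cosh x * sin y)"
  define h where "h = (\<lambda>x y. (cosh (2 * x) - cos (2 * y)) / (2::real))"
  define X where "X = (\<lambda>(x::real) (y::real) \<alpha> \<beta>. p x y * \<alpha> - r x y * \<beta>)"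
  define Y where "Y = (\<lambda>(x::real) (y::real) \<alpha> \<beta>. r x y * \<alpha> + p x y * \<beta>)"
  define a1 where "a1 = (\<lambda>x y. u1' x * v1 y)"
  define b1 where "b1 = (\<lambda>x y. u1 x * v1' y)"
  define a2 where "a2 = (\<lambda>x y. u2' x * v2 y)"
  define b2 where "b2 = (\<lambda>x y. u2 x * v2' y)"
  define z1 where "z1 = (\<lambda>x y. u1 x * v1 y)"
  define z2 where "z2 = (\<lambda>x y. u2 x * v2 y)"
  define S where "S = (\<lambda>x y. \<mu>\<^sup>2 * (h x y * z1 x y * z2 x y + s1 * s2 * (a1 x y * a2 x y + b1 x y * b2 x y)))"
  \<comment> \<open>All four components are kept, since \<open>Sc\<close> stands outside the
    integral: the first projection may be moved inside once the whole quaternion is known to be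
    integrable.\<close>
  define G :: "real \<Rightarrow> real \<Rightarrow> quat" where "G = (\<lambda>x y. (S x y,
     \<mu>\<^sup>2 * (s1 * z2 x y * X x y (a1 x y) (b1 x y) - s2 * z1 x y * X x y (a2 x y) (b2 x y)),
     \<mu>\<^sup>2 * (s1 * z2 x y * Y x y (a1 x y) (b1 x y) - s2 * z1 x y * Y x y (a2 x y) (b2 x y)),
     \<mu>\<^sup>2 * (- s1 * s2 * (a1 x y * b2 x y - b1 x y * a2 x y))))"
  have cu: "continuous_on A u1" "continuous_on A u2" "continuous_on A v1" "continuous_on A v2" for A
    using continuous_on_DERIV u1 u2 v1 v2 by blast+
  have c': "continuous_on A u1'" "continuous_on A u2'" "continuous_on A v1'" "continuous_on A v2'" for A
    using c continuous_on_subset by blast+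
  have integrand: "ell_weight \<mu> x y *\<^sub>R qmul (qcnj (?f1 x y)) (?f2 x y) = G x y" if "x \<noteq> 0" for x y
  proof -
    have h0: "h x y \<noteq> 0" using elliptic_weight_vanishes[of x y] that by (auto simp: h_def)
    have hpr: "h x y = (p x y)\<^sup>2 + (r x y)\<^sup>2" by (simp add: h_def p_def r_def elliptic_weight_eq)
    have k: "2 / (cosh (2 * x) - cos (2 * y)) = 1 / h x y" by (simp add: h_def)
    have f1: "?f1 x y = (z1 x y, - s1 * (X x y (a1 x y) (b1 x y) / h x y), - s1 * (Y x y (a1 x y) (b1 x y) / h x y), 0)"
      unfolding Dell_separated[OF u1 v1] Let_def
      by (simp add: k qreal_def X_def Y_def a1_def b1_def z1_def p_def r_def)
    have f2: "?f2 x y = (z2 x y, - s2 * (X x y (a2 x y) (b2 x y) / h x y), - s2 * (Y x y (a2 x y) (b2 x y) / h x y), 0)"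
      unfolding Dell_separated[OF u2 v2] Let_def
      by (simp add: k qreal_def X_def Y_def a2_def b2_def z2_def p_def r_def)
    have "ell_weight \<mu> x y *\<^sub>R qmul (qcnj (?f1 x y)) (?f2 x y) =
        \<mu>\<^sup>2 *\<^sub>R (h x y *\<^sub>R qmul (qcnj (?f1 x y)) (?f2 x y))"
      by (simp add: ell_weight_def h_def)
    also have "\<dots> = G x y"
      unfolding f1 f2 X_def Y_def weighted_quaternion_product[OF hpr h0]
      by (simp add: G_def S_def X_def Y_def)
    finally show ?thesis .
  qed
  \<comment> \<open>At x = 0 the weight can vanish, and then \<open>Dell\<close> has the default
    value of a division by zero, so the two integrands may differ there; a single point does not
    affect the inner integral.\<close>
  have "integral {0..xi \<mu>} (\<lambda>x. ell_weight \<mu> x y *\<^sub>R qmul (qcnj (?f1 x y)) (?f2 x y)) =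
      integral {0..xi \<mu>} (\<lambda>x. G x y)" for y
    by (rule integral_spike[of "{0}"]) (auto simp: integrand)
  then have inner: "ell_inner \<mu> ?f1 ?f2 = Sc (integral {0..2 * pi} (\<lambda>y. integral {0..xi \<mu>} (\<lambda>x. G x y)))"
    by (simp add: ell_inner_def)
  have cont: "continuous_on A (\<lambda>w. f (g w))"
    if "\<And>B. continuous_on B f" "continuous_on A g" for f g :: "_ \<Rightarrow> real" and A :: "(real \<times> real) set"
    using continuous_on_compose2[OF that] by blast
  have cG: "continuous_on A (\<lambda>(y, x). G x y)" for A
    unfolding G_def S_def X_def Y_def a1_def b1_def a2_def b2_def z1_def z2_def h_def p_def r_def case_prod_beta
    by (intro continuous_intros cont[OF cu(1)] cont[OF cu(2)] cont[OF cu(3)] cont[OF cu(4)]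
      cont[OF c'(1)] cont[OF c'(2)] cont[OF c'(3)] cont[OF c'(4)])
      (auto intro!: continuous_intros)
  have int_x: "(\<lambda>x. G x y) integrable_on {0..xi \<mu>}" for y
  proof (rule integrable_continuous_real)
    show "continuous_on {0..xi \<mu>} (\<lambda>x. G x y)"
      using continuous_on_compose[OF continuous_on_Pair[OF continuous_on_const continuous_on_id] cG, of _ y]
      by (simp add: o_def)
  qed
  have int_y: "(\<lambda>y. integral {0..xi \<mu>} (\<lambda>x. G x y)) integrable_on {0..2 * pi}"
    using integral_continuous_on_param[of "{0..2 * pi}" 0 "xi \<mu>" "\<lambda>y x. G x y"] cG
    by (intro integrable_continuous_real) simp
  have "Sc (integral {0..2 * pi} (\<lambda>y. integral {0..xi \<mu>} (\<lambda>x. G x y)))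
      = integral {0..2 * pi} (\<lambda>y. fst (integral {0..xi \<mu>} (\<lambda>x. G x y)))"
    unfolding Sc_def using integral_linear[OF int_y bounded_linear_fst] by (simp add: o_def)
  also have "\<dots> = integral {0..2 * pi} (\<lambda>y. integral {0..xi \<mu>} (\<lambda>x. S x y))"
  proof -
    have "fst (integral {0..xi \<mu>} (\<lambda>x. G x y)) = integral {0..xi \<mu>} (\<lambda>x. S x y)" for y
      using integral_linear[OF int_x bounded_linear_fst] by (simp add: o_def G_def)
    then show ?thesis by simp
  qed
  also have "(\<lambda>y. integral {0..xi \<mu>} (\<lambda>x. S x y)) =
     (\<lambda>y. integral {0..xi \<mu>} (\<lambda>x.
        (cosh (2 * x) * u1 x * u2 x) * (\<mu>\<^sup>2 / 2 * (v1 y * v2 y))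
      + (u1 x * u2 x) * (- (\<mu>\<^sup>2 / 2) * (cos (2 * y) * v1 y * v2 y))
      + (u1' x * u2' x) * (\<mu>\<^sup>2 * s1 * s2 * (v1 y * v2 y))
      + (u1 x * u2 x) * (\<mu>\<^sup>2 * s1 * s2 * (v1' y * v2' y))))"
    by (simp add: S_def h_def z1_def z2_def a1_def a2_def b1_def b2_def algebra_simps diff_divide_distrib)
  also have "integral {0..2 * pi} \<dots> = ?rhs"
    by (subst integral_separated_sum)
      (auto intro!: continuous_intros cu c' simp: algebra_simps)
  finally show ?thesis using inner by simp
qed

section \<open>Green's formula in separated form and orthogonality\<close>

text \<open>The left side integrates (f g')' with g'' replaced by means of the equation. Both
  Mathieu equations fit: k = a, l = -2q, w = cosh 2x radially, and k = -a, l = 2q, w = cos 2x in the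
  angle.\<close>

lemma integral_by_parts_ode:
  fixes f g :: "real \<Rightarrow> real"
  assumes "a \<le> b" and f: "\<And>x. (f has_real_derivative f' x) (at x)"
    and g: "\<And>x. (g has_real_derivative g' x) (at x)"
    and g': "\<And>x. (g' has_real_derivative (k + l * w x) * g x) (at x)"
    and c: "continuous_on {a..b} f'" "continuous_on {a..b} w"
  shows "integral {a..b} (\<lambda>x. f' x * g' x) + k * integral {a..b} (\<lambda>x. f x * g x)
    + l * integral {a..b} (\<lambda>x. w x * f x * g x) = f b * g' b - f a * g' a"
proof -
  have cont: "continuous_on {a..b} f" "continuous_on {a..b} g" "continuous_on {a..b} g'"
    by (rule continuous_on_DERIV[OF f] continuous_on_DERIV[OF g] continuous_on_DERIV[OF g'])+
  have "((\<lambda>x. f' x * g' x + k * (f x * g x) + l * (w x * f x * g x)) has_integral (f b * g' b - f a * g' a)) {a..b}"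
  proof (rule fundamental_theorem_of_calculus[OF \<open>a \<le> b\<close>])
    fix x
    have "((\<lambda>x. f x * g' x) has_real_derivative f' x * g' x + k * (f x * g x) + l * (w x * f x * g x)) (at x)"
      by (auto intro!: derivative_eq_intros f g' simp: algebra_simps)
    then show "((\<lambda>x. f x * g' x) has_vector_derivative f' x * g' x + k * (f x * g x) + l * (w x * f x * g x))
        (at x within {a..b})"
      by (simp add: has_real_derivative_iff_has_vector_derivative has_vector_derivative_at_within)
  qed
  moreover have "((\<lambda>x. f' x * g' x + k * (f x * g x) + l * (w x * f x * g x)) has_integral
      (integral {a..b} (\<lambda>x. f' x * g' x) + k * integral {a..b} (\<lambda>x. f x * g x)
        + l * integral {a..b} (\<lambda>x. w x * f x * g x))) {a..b}"
    by (intro has_integral_add has_integral_mult_right integrable_integral integrable_continuous_real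
        continuous_intros cont c)
  ultimately show ?thesis using has_integral_unique by blast
qed

text \<open>Collects both factors of a mode in the form used for integration by parts, with the data
  that cancel boundary terms: parity conditions at \<xi> = 0 and periodicity in \<eta>.\<close>

lemma periodic_mathieu_mode:
  assumes "periodic_mathieu_solution s a q v"
  obtains u' v' where
    "\<And>x. (modified s v has_real_derivative u' x) (at x)"
    "\<And>x. (u' has_real_derivative (a + (- (2 * q)) * cosh (2 * x)) * modified s v x) (at x)"
    "\<And>x. (v has_real_derivative v' x) (at x)"
    "\<And>x. (v' has_real_derivative (- a + 2 * q * cos (2 * x)) * v x) (at x)"
    "s = OddP \<Longrightarrow> modified s v 0 = 0" "s = EvenP \<Longrightarrow> u' 0 = 0"
    "v (2 * pi) = v 0" "v' (2 * pi) = v' 0"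
proof -
  have v: "mathieu_solution a q v" "\<And>x. v (x + 2 * pi) = v x"
    using assms by (auto simp: periodic_mathieu_solution_def)
  obtain v' v'' where v': "\<And>x. (v has_real_derivative v' x) (at x)"
    "\<And>x. (v' has_real_derivative v'' x) (at x)" "\<And>x. v'' x + (a - 2 * q * cos (2 * x)) * v x = 0"
    using v(1) unfolding mathieu_solution_def by blast
  obtain u' where u': "\<And>x. (modified s v has_real_derivative u' x) (at x)"
    "\<And>x. (u' has_real_derivative (a - 2 * q * cosh (2 * x)) * modified s v x) (at x)"
    "s = OddP \<Longrightarrow> modified s v 0 = 0" "s = EvenP \<Longrightarrow> u' 0 = 0"
    using modified_mathieu[OF v(1)] by blast
  have "v'' x = (- a + 2 * q * cos (2 * x)) * v x" for x using v'(3)[of x] by algebra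
  \<comment> \<open>The derivative inherits the period by differentiating v(x + 2\<pi>) = v(x) at
    0.\<close>
  moreover have "v' (2 * pi) = v' 0"
  proof -
    have "((\<lambda>x. v (x + 2 * pi)) has_real_derivative v' (2 * pi)) (at 0)"
      using v'(1)[of "0 + 2 * pi"] unfolding DERIV_shift by simp
    then show ?thesis using v'(1)[of 0] by (simp add: v(2) DERIV_unique)
  qed
  moreover have "v (2 * pi) = v 0" using v(2)[of 0] by simp
  ultimately show ?thesis using that[of u' v'] u' v' by simp
qed

text \<open>This is \<open>Mrqm\<close> with -(1/\<lambda>)(D - \<lambda>) multiplied out and c =
  1/\<lambda> left free.\<close>

definition rqm_field :: "parity \<Rightarrow> (real \<Rightarrow> real) \<Rightarrow> real \<Rightarrow> real \<Rightarrow> real \<Rightarrow> quat" where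
  "rqm_field s v c = (\<lambda>\<xi> \<eta>. qreal (modified s v \<xi> * v \<eta>)
     - c *\<^sub>R Dell (\<lambda>x y. qreal (modified s v x * v y)) \<xi> \<eta>)"

text \<open>The factors \<open>c1\<close>, \<open>c2\<close> are arbitrary because the scalar part
  and the gradient part of the inner product vanish separately.\<close>

lemma rqm_field_orthogonal:
  assumes X: "0 \<le> xi \<mu>"
    and v1: "periodic_mathieu_solution s1 a1 q1 v1" and v2: "periodic_mathieu_solution s2 a2 q2 v2"
    and boundary: "modified s1 v1 (xi \<mu>) = 0" "modified s2 v2 (xi \<mu>) = 0"
    and ne: "(s1, q1, a1) \<noteq> (s2, q2, a2)"
  shows "ell_inner \<mu> (rqm_field s1 v1 c1) (rqm_field s2 v2 c2) = 0"
proof -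
  \<comment> \<open>The six integrals below satisfy linear relations with coefficients \<open>a\<^sub>i\<close>, \<open>q\<^sub>i\<close>; the claim follows from
    these by elimination.\<close>
  define u1 where "u1 = modified s1 v1"
  define u2 where "u2 = modified s2 v2"
  obtain u1' v1' where 1: "\<And>x. (u1 has_real_derivative u1' x) (at x)"
    "\<And>x. (u1' has_real_derivative (a1 + (- (2 * q1)) * cosh (2 * x)) * u1 x) (at x)"
    "\<And>x. (v1 has_real_derivative v1' x) (at x)"
    "\<And>x. (v1' has_real_derivative (- a1 + 2 * q1 * cos (2 * x)) * v1 x) (at x)"
    "s1 = OddP \<Longrightarrow> u1 0 = 0" "s1 = EvenP \<Longrightarrow> u1' 0 = 0"
    "v1 (2 * pi) = v1 0" "v1' (2 * pi) = v1' 0"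
    using periodic_mathieu_mode[OF v1] unfolding u1_def by blast
  obtain u2' v2' where 2: "\<And>x. (u2 has_real_derivative u2' x) (at x)"
    "\<And>x. (u2' has_real_derivative (a2 + (- (2 * q2)) * cosh (2 * x)) * u2 x) (at x)"
    "\<And>x. (v2 has_real_derivative v2' x) (at x)"
    "\<And>x. (v2' has_real_derivative (- a2 + 2 * q2 * cos (2 * x)) * v2 x) (at x)"
    "s2 = OddP \<Longrightarrow> u2 0 = 0" "s2 = EvenP \<Longrightarrow> u2' 0 = 0"
    "v2 (2 * pi) = v2 0" "v2' (2 * pi) = v2' 0"
    using periodic_mathieu_mode[OF v2] unfolding u2_def by blast
  note cont = continuous_on_DERIV[OF 1(2)] continuous_on_DERIV[OF 2(2)]
    continuous_on_DERIV[OF 1(4)] continuous_on_DERIV[OF 2(4)]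
  define U where "U = integral {0..xi \<mu>} (\<lambda>x. u1 x * u2 x)"
  define Uw where "Uw = integral {0..xi \<mu>} (\<lambda>x. cosh (2 * x) * u1 x * u2 x)"
  define U' where "U' = integral {0..xi \<mu>} (\<lambda>x. u1' x * u2' x)"
  define V where "V = integral {0..2 * pi} (\<lambda>x. v1 x * v2 x)"
  define Vw where "Vw = integral {0..2 * pi} (\<lambda>x. cos (2 * x) * v1 x * v2 x)"
  define V' where "V' = integral {0..2 * pi} (\<lambda>x. v1' x * v2' x)"
  have inner: "ell_inner \<mu> (rqm_field s1 v1 c1) (rqm_field s2 v2 c2) =
      \<mu>\<^sup>2 / 2 * (Uw * V - U * Vw) + \<mu>\<^sup>2 * c1 * c2 * (U' * V + U * V')"
    unfolding rqm_field_def u1_def[symmetric] u2_def[symmetric]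
      ell_inner_separated[OF 1(1) 2(1) 1(3) 2(3) cont] U_def Uw_def U'_def V_def Vw_def V'_def ..
  have V2: "V' - a2 * V + 2 * q2 * Vw = 0"
    using integral_by_parts_ode[where w = "\<lambda>x. cos (2 * x)", OF _ 1(3) 2(3,4) cont(3), of 0 "2 * pi"]
    by (simp add: V_def V'_def Vw_def 1(7) 2(8) continuous_intros)
  \<comment> \<open>Integration by parts uses the equation of one factor only; exchanging the
    factors gives the second relation, with \<open>a1\<close> and \<open>q1\<close>.\<close>
  have swap: "V = integral {0..2 * pi} (\<lambda>x. v2 x * v1 x)"
    "Vw = integral {0..2 * pi} (\<lambda>x. cos (2 * x) * v2 x * v1 x)"
    "V' = integral {0..2 * pi} (\<lambda>x. v2' x * v1' x)"
    by (simp_all add: V_def Vw_def V'_def mult_ac)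
  have V1: "V' - a1 * V + 2 * q1 * Vw = 0"
    using integral_by_parts_ode[where w = "\<lambda>x. cos (2 * x)", OF _ 2(3) 1(3,4) cont(4), of 0 "2 * pi"]
    by (simp add: swap 2(7) 1(8) continuous_intros)
  show ?thesis
  proof (cases "s1 = s2")
    case True
    \<comment> \<open>With equal parities either both radial functions or both their derivatives
      vanish at 0.\<close>
    have corner: "u1 0 * u2' 0 = 0" "u2 0 * u1' 0 = 0"
      using 1(5,6) 2(5,6) True by (cases s1; simp)+
    have U2: "U' + a2 * U - 2 * q2 * Uw = 0"
      using integral_by_parts_ode[where w = "\<lambda>x. cosh (2 * x)", OF X 1(1) 2(1,2) cont(1)]
        boundary(1) corner(1)
      by (simp add: U_def U'_def Uw_def u1_def[symmetric] continuous_intros)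
    have U1: "U' + a1 * U - 2 * q1 * Uw = 0"
      using integral_by_parts_ode[where w = "\<lambda>x. cosh (2 * x)", OF X 2(1) 1(1,2) cont(2)]
        boundary(2) corner(2)
      by (simp add: U_def U'_def Uw_def u2_def[symmetric] continuous_intros mult_ac)
    \<comment> \<open>The eigenvalues cancel in U' V + U V', leaving the same quantity multiplied by
      2 \<open>q1\<close> and by 2 \<open>q2\<close>.\<close>
    have S: "U' * V + U * V' = 2 * q1 * (Uw * V - U * Vw)" "U' * V + U * V' = 2 * q2 * (Uw * V - U * Vw)"
      using U1 U2 V1 V2 by algebra+
    have "Uw * V - U * Vw = 0"
    proof (cases "q1 = q2")
      case True
      then have "a1 \<noteq> a2" using ne \<open>s1 = s2\<close> by simp
      \<comment> \<open>Differences of the two radial and of the two angular relations, where the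
        weighted integrals cancel because the parameters agree.\<close>
      moreover have "(a1 - a2) * U = 0" "(a1 - a2) * V = 0" using U1 U2 V1 V2 True by algebra+
      ultimately show ?thesis by simp
    next
      case False
      with S show ?thesis by simp
    qed
    then show ?thesis using S(1) by (simp add: inner)
  next
    case False
    have par: "has_parity s1 v1" "has_parity s2 v2" "\<And>x. v1 (x + 2 * pi) = v1 x" "\<And>x. v2 (x + 2 * pi) = v2 x"
      using v1 v2 by (auto simp: periodic_mathieu_solution_def)
    have odd: "v1 (- x) * v2 (- x) = - (v1 x * v2 x)" for x
      using par(1,2) False by (cases s1; cases s2) auto
    have "V = 0" unfolding V_def by (rule integral_odd_periodic) (simp_all add: odd par)
    moreover have "Vw = 0"
      unfolding Vw_def
    proof (rule integral_odd_periodic)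
      show "cos (2 * - x) * v1 (- x) * v2 (- x) = - (cos (2 * x) * v1 x * v2 x)" for x
        using odd[of x] by (simp add: mult.assoc)
    qed (simp add: par cos_add distrib_left)
    \<comment> \<open>Once V and Vw vanish, \<open>V1\<close> reduces to V' = 0.\<close>
    ultimately show ?thesis using V1 by (simp add: inner)
  qed
qed

section \<open>Norms\<close>

text \<open>Without integrability the integral has the default value 0.\<close>

lemma integral_nonneg_everywhere:
  fixes f :: "real \<Rightarrow> real"
  assumes "\<And>x. 0 \<le> f x"
  shows "0 \<le> integral A f"
  by (cases "f integrable_on A") (simp_all add: integral_nonneg not_integrable_integral assms)

text \<open>The diagonal case of the separated inner product. Since \<open>ell_norm\<close> is a
  square root, its square returns the inner product by way of nonnegativity of each term.\<close>

lemma rqm_field_norm: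
  assumes v: "periodic_mathieu_solution s a q v"
  shows "(ell_norm \<mu> (rqm_field s v c))\<^sup>2 =
      (ell_norm \<mu> (\<lambda>\<xi> \<eta>. qreal (modified s v \<xi> * v \<eta>)))\<^sup>2
      + \<mu>\<^sup>2 * c\<^sup>2 * integral {0..2 * pi} (\<lambda>\<eta>. (v \<eta>)\<^sup>2) * integral {0..xi \<mu>} (\<lambda>\<xi>. (deriv (modified s v) \<xi>)\<^sup>2)
      + \<mu>\<^sup>2 * c\<^sup>2 * integral {0..2 * pi} (\<lambda>\<eta>. (deriv v \<eta>)\<^sup>2) * integral {0..xi \<mu>} (\<lambda>\<xi>. (modified s v \<xi>)\<^sup>2)" (is ?norm)
    and "(ell_norm \<mu> (\<lambda>\<xi> \<eta>. qreal (modified s v \<xi> * v \<eta>)))\<^sup>2 =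
      integral {0..2 * pi} (\<lambda>\<eta>. integral {0..xi \<mu>} (\<lambda>\<xi>.
        (modified s v \<xi> * v \<eta>)\<^sup>2 * (\<mu>\<^sup>2 / 2 * (cosh (2 * \<xi>) - cos (2 * \<eta>)))))" (is ?scalar)
proof -
  define u where "u = modified s v"
  obtain u' v' where 1: "\<And>x. (u has_real_derivative u' x) (at x)"
    "\<And>x. (u' has_real_derivative (a + (- (2 * q)) * cosh (2 * x)) * u x) (at x)"
    "\<And>x. (v has_real_derivative v' x) (at x)"
    "\<And>x. (v' has_real_derivative (- a + 2 * q * cos (2 * x)) * v x) (at x)"
    "s = OddP \<Longrightarrow> u 0 = 0" "s = EvenP \<Longrightarrow> u' 0 = 0"
    "v (2 * pi) = v 0" "v' (2 * pi) = v' 0"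
    using periodic_mathieu_mode[OF v] unfolding u_def by blast
  note cont = continuous_on_DERIV[OF 1(2)] continuous_on_DERIV[OF 1(4)]
  define U where "U = integral {0..xi \<mu>} (\<lambda>x. (u x)\<^sup>2)"
  define Uw where "Uw = integral {0..xi \<mu>} (\<lambda>x. cosh (2 * x) * u x * u x)"
  define U' where "U' = integral {0..xi \<mu>} (\<lambda>x. (u' x)\<^sup>2)"
  define V where "V = integral {0..2 * pi} (\<lambda>x. (v x)\<^sup>2)"
  define Vw where "Vw = integral {0..2 * pi} (\<lambda>x. cos (2 * x) * v x * v x)"
  define V' where "V' = integral {0..2 * pi} (\<lambda>x. (v' x)\<^sup>2)"
  have inner: "ell_inner \<mu> (rqm_field s v c) (rqm_field s v c) =
      \<mu>\<^sup>2 / 2 * (Uw * V - U * Vw) + \<mu>\<^sup>2 * c * c * (U' * V + U * V')" for c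
    unfolding rqm_field_def u_def[symmetric]
      ell_inner_separated[OF 1(1) 1(1) 1(3) 1(3) cont(1,1,2,2)]
      U_def Uw_def U'_def V_def Vw_def V'_def power2_eq_square ..
  \<comment> \<open>The scalar part is the field with \<open>c = 0\<close>, so one computation serves both claims.\<close>
  have scalar_eq: "rqm_field s v 0 = (\<lambda>\<xi> \<eta>. qreal (u \<xi> * v \<eta>))"
    by (simp add: rqm_field_def u_def)
  define I where "I = integral {0..2 * pi} (\<lambda>\<eta>. integral {0..xi \<mu>} (\<lambda>\<xi>.
        (u \<xi> * v \<eta>)\<^sup>2 * (\<mu>\<^sup>2 / 2 * (cosh (2 * \<xi>) - cos (2 * \<eta>)))))"
  have I: "I = \<mu>\<^sup>2 / 2 * (Uw * V - U * Vw)"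
  proof -
    \<comment> \<open>Two zero terms pad the sum to the shape of
      \<open>integral_separated_sum\<close>.\<close>
    have "I = integral {0..2 * pi} (\<lambda>y. integral {0..xi \<mu>} (\<lambda>x.
        (cosh (2 * x) * u x * u x) * (\<mu>\<^sup>2 / 2 * (v y)\<^sup>2)
      + (u x)\<^sup>2 * (- (\<mu>\<^sup>2 / 2) * (cos (2 * y) * v y * v y)) + 0 * (0 * 0) + 0 * (0 * 0)))"
      unfolding I_def by (simp add: algebra_simps power2_eq_square)
    also have "\<dots> = \<mu>\<^sup>2 / 2 * (Uw * V - U * Vw)"
      by (subst integral_separated_sum)
        (auto intro!: continuous_intros continuous_on_DERIV[OF 1(1)] continuous_on_DERIV[OF 1(3)]
          simp: U_def V_def Uw_def Vw_def algebra_simps)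
    finally show ?thesis .
  qed
  have "0 \<le> cosh (2 * x) - cos (2 * y)" for x y :: real
    by (simp add: elliptic_weight_eq)
  then have I0: "0 \<le> I" unfolding I_def by (intro integral_nonneg_everywhere mult_nonneg_nonneg) auto
  have nonneg: "0 \<le> U" "0 \<le> U'" "0 \<le> V" "0 \<le> V'"
    unfolding U_def U'_def V_def V'_def by (intro integral_nonneg_everywhere; simp)+
  have norm: "(ell_norm \<mu> (rqm_field s v c))\<^sup>2 = I + \<mu>\<^sup>2 * c * c * (U' * V + U * V')" for c
  proof -
    have "0 \<le> \<mu>\<^sup>2 * (c * c) * (U' * V + U * V')" using nonneg by simp
    then show ?thesis using I0 by (simp add: ell_norm_def inner I mult.assoc)
  qed
  have d: "deriv u = u'" "deriv v = v'" using 1 by (auto intro!: DERIV_imp_deriv)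
  show ?scalar using norm[of 0] by (simp add: scalar_eq I_def u_def)
  have "(ell_norm \<mu> (\<lambda>\<xi> \<eta>. qreal (u \<xi> * v \<eta>)))\<^sup>2 = I" using norm[of 0] by (simp add: scalar_eq)
  with norm[of c] show ?norm unfolding u_def[symmetric] d U_def[symmetric] U'_def[symmetric]
      V_def[symmetric] V'_def[symmetric] by (simp add: power2_eq_square algebra_simps)
qed

section \<open>Passage to the zero-boundary RQM-functions\<close>

theorem theorem4p4:
  fixes \<mu> :: real
    and \<phi> :: "parity \<Rightarrow> nat \<Rightarrow> real \<Rightarrow> real \<Rightarrow> real"
    and qz :: "parity \<Rightarrow> nat \<Rightarrow> nat \<Rightarrow> real"
  assumes "0 < \<mu>" and "\<mu> < 1"
    and "mathieu_functions \<phi>"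
    and "zero_parameters \<phi> (xi \<mu>) qz"
  shows "(\<forall>s n m s' n' m'.
            first_index s \<le> n \<longrightarrow> 1 \<le> m \<longrightarrow> first_index s' \<le> n' \<longrightarrow> 1 \<le> m' \<longrightarrow>
            (s, n, m) \<noteq> (s', n', m') \<longrightarrow>
            ell_inner \<mu> (Zrqm \<phi> qz s n m) (Zrqm \<phi> qz s' n' m') = 0) \<and>
         (\<forall>s n m. first_index s \<le> n \<longrightarrow> 1 \<le> m \<longrightarrow>
            (let q = qz s n m;
                 \<zeta> = zeta \<phi> s n q
             in (ell_norm \<mu> (Zrqm \<phi> qz s n m))\<^sup>2 =
                  (ell_norm \<mu> (\<lambda>\<xi> \<eta>. qreal (\<zeta> \<xi> \<eta>)))\<^sup>2
                  + \<mu>\<^sup>2 / (4 * q) * (1 + (if n = 0 then 1 else 0)) * pi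
                      * integral {0..xi \<mu>} (\<lambda>\<xi>. (deriv (psi \<phi> s n q) \<xi>)\<^sup>2)
                  + \<mu>\<^sup>2 / (4 * q)
                      * integral {0..2 * pi} (\<lambda>\<eta>. (deriv (\<phi> s n q) \<eta>)\<^sup>2)
                      * integral {0..xi \<mu>} (\<lambda>\<xi>. (psi \<phi> s n q \<xi>)\<^sup>2) \<and>
                (ell_norm \<mu> (\<lambda>\<xi> \<eta>. qreal (\<zeta> \<xi> \<eta>)))\<^sup>2 =
                  integral {0..2 * pi} (\<lambda>\<eta>. integral {0..xi \<mu>} (\<lambda>\<xi>.
                    (\<zeta> \<xi> \<eta>)\<^sup>2 * (\<mu>\<^sup>2 / 2 * (cosh (2 * \<xi>) - cos (2 * \<eta>)))))))"
proof -
  obtain ev where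
    ev: "\<And>s q. 0 < q \<Longrightarrow> increasing_enumeration (first_index s) (ev s q) (mathieu_eigenvalues s q)"
    and sol: "\<And>s n q. first_index s \<le> n \<Longrightarrow> 0 < q \<Longrightarrow> periodic_mathieu_solution s (ev s q n) q (\<phi> s n q)"
    and nrm: "\<And>s n q. first_index s \<le> n \<Longrightarrow> 0 < q \<Longrightarrow>
      sqrt (integral {0..2 * pi} (\<lambda>\<eta>. (\<phi> s n q \<eta>)\<^sup>2)) = (if s = EvenP \<and> n = 0 then sqrt (2 * pi) else sqrt pi)"
    using assms(3) unfolding mathieu_functions_def by blast
  have enum: "increasing_enumeration 1 (qz s n) {q. 0 < q \<and> psi \<phi> s n q (xi \<mu>) = 0}"
    if "first_index s \<le> n" for s n
    using assms(4) that by (simp add: zero_parameters_def)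
  have qz: "0 < qz s n m" "modified s (\<phi> s n (qz s n m)) (xi \<mu>) = 0"
    if "first_index s \<le> n" "1 \<le> m" for s n and m :: nat
  proof -
    have "qz s n m \<in> {q. 0 < q \<and> psi \<phi> s n q (xi \<mu>) = 0}"
      using enum[OF that(1)] that(2) unfolding increasing_enumeration_def by blast
    then show "0 < qz s n m" "modified s (\<phi> s n (qz s n m)) (xi \<mu>) = 0" by (simp_all add: psi_def)
  qed
  \<comment> \<open>With \<lambda> = 2 sqrt q one has \<lambda>^2 / 4 = q, so the Mathieu parameter
    is the zero itself and c = 1 / (2 sqrt q).\<close>
  have Z: "Zrqm \<phi> qz s n m = rqm_field s (\<phi> s n (qz s n m)) (1 / (2 * sqrt (qz s n m)))"
    if "first_index s \<le> n" "1 \<le> m" for s n and m :: nat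
  proof -
    have "(2 * sqrt (qz s n m))\<^sup>2 / 4 = qz s n m" "2 * sqrt (qz s n m) \<noteq> 0"
      using qz(1)[OF that] by (simp_all add: power_mult_distrib)
    then show ?thesis
      by (simp add: Zrqm_def Mrqm_def rqm_field_def zeta_def psi_def Let_def fun_eq_iff
          scaleR_diff_right)
  qed
  have X: "0 \<le> xi \<mu>" using xi_pos[OF assms(1,2)] by simp
  show ?thesis
  proof (intro conjI allI impI)
    fix s s' and n m n' m' :: nat
    assume 1: "first_index s \<le> n" "1 \<le> m" and 2: "first_index s' \<le> n'" "1 \<le> m'"
      and ne: "(s, n, m) \<noteq> (s', n', m')"
    \<comment> \<open>For equal parity and parameter, the eigenvalue enumeration is injective and
      gives n = n'; then the enumeration of zeros for this n gives m = m'.\<close>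
    have "(s, qz s n m, ev s (qz s n m) n) \<noteq> (s', qz s' n' m', ev s' (qz s' n' m') n')"
    proof
      assume eq: "(s, qz s n m, ev s (qz s n m) n) = (s', qz s' n' m', ev s' (qz s' n' m') n')"
      have "inj_on (ev s (qz s n m)) {first_index s..}"
        using ev[OF qz(1)[OF 1], of s] strict_mono_on_imp_inj_on unfolding increasing_enumeration_def by blast
      then have "n = n'" by (rule inj_onD) (use eq 1 2 in auto)
      moreover have "inj_on (qz s n) {1..}"
        using enum[OF 1(1)] strict_mono_on_imp_inj_on unfolding increasing_enumeration_def by blast
      then have "m = m'" by (rule inj_onD) (use eq 1 2 \<open>n = n'\<close> in auto)
      ultimately show False using ne eq by simp
    qed
    then show "ell_inner \<mu> (Zrqm \<phi> qz s n m) (Zrqm \<phi> qz s' n' m') = 0"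
      unfolding Z[OF 1] Z[OF 2]
      by (intro rqm_field_orthogonal[OF X sol[OF 1(1) qz(1)[OF 1]] sol[OF 2(1) qz(1)[OF 2]]
            qz(2)[OF 1] qz(2)[OF 2]])
  next
    fix s and n m :: nat
    assume 1: "first_index s \<le> n" "1 \<le> m"
    define q where "q = qz s n m"
    have q: "0 < q" using qz(1)[OF 1] by (simp add: q_def)
    have c: "(1 / (2 * sqrt q))\<^sup>2 = 1 / (4 * q)" using q by (simp add: power_divide power_mult_distrib)
    \<comment> \<open>Odd indices start at 1, so n = 0 singles out \<open>ce\<^sub>0\<close>, and
      the exceptional normalization becomes the factor 1 + \<delta>.\<close>
    have "n = 0 \<Longrightarrow> s = EvenP" using 1(1) by (cases s) auto
    then have V: "integral {0..2 * pi} (\<lambda>\<eta>. (\<phi> s n q \<eta>)\<^sup>2) = (1 + (if n = 0 then 1 else 0)) * pi"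
      using nrm[OF 1(1) q] by (auto split: if_splits)
    note norms = rqm_field_norm[OF sol[OF 1(1) q], of \<mu>, unfolded V]
    show "let q = qz s n m; \<zeta> = zeta \<phi> s n q
             in (ell_norm \<mu> (Zrqm \<phi> qz s n m))\<^sup>2 =
                  (ell_norm \<mu> (\<lambda>\<xi> \<eta>. qreal (\<zeta> \<xi> \<eta>)))\<^sup>2
                  + \<mu>\<^sup>2 / (4 * q) * (1 + (if n = 0 then 1 else 0)) * pi
                      * integral {0..xi \<mu>} (\<lambda>\<xi>. (deriv (psi \<phi> s n q) \<xi>)\<^sup>2)
                  + \<mu>\<^sup>2 / (4 * q)
                      * integral {0..2 * pi} (\<lambda>\<eta>. (deriv (\<phi> s n q) \<eta>)\<^sup>2)
                      * integral {0..xi \<mu>} (\<lambda>\<xi>. (psi \<phi> s n q \<xi>)\<^sup>2) \<and>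
                (ell_norm \<mu> (\<lambda>\<xi> \<eta>. qreal (\<zeta> \<xi> \<eta>)))\<^sup>2 =
                  integral {0..2 * pi} (\<lambda>\<eta>. integral {0..xi \<mu>} (\<lambda>\<xi>.
                    (\<zeta> \<xi> \<eta>)\<^sup>2 * (\<mu>\<^sup>2 / 2 * (cosh (2 * \<xi>) - cos (2 * \<eta>)))))"
      unfolding Let_def q_def[symmetric] zeta_def psi_def Z[OF 1] norms(1) c
      by (rule conjI[OF _ norms(2)]) simp
  qed
qed

end
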